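(* Let $F\in\mathbb{N}\setminus\{0\}$ and let $\mathcal{A}(F)$ be the set of all numerical semigroups with Frobenius number $F$. Then $\mathcal{A}(F)$ is a covariety. Moreover, its minimum is $\Delta(\mathcal{A}(F))=\{0\}\cup\{z\in\mathbb{N}\mid z\geq F+1\}$.
   Context: Let $\mathbb{N}=\{0,1,2,\dots\}$. A numerical semigroup is a subset $S\subseteq\mathbb{N}$ that contains $0$, is closed under addition, and has finite complement $\mathbb{N}\setminus S$. Its multiplicity is $m(S)=\min(S\setminus\{0\})$ and its Frobenius number is $F(S)=\max\{z\in\mathbb{Z}\mid z\notin S\}$. A covariety is a nonempty family $\mathcal{C}$ of numerical semigroups such that: (1) $\mathcal{C}$ has a minimum $\Delta(\mathcal{C})=\min(\mathcal{C})$ with respect to set inclusion; (2) if $S,T\in\mathcal{C}$ then $S\cap T\in\mathcal{C}$; (3) if $S\in\mathcal{C}$ and $S\neq\Delta(\mathcal{C})$ then $S\setminus\{m(S)\}\in\mathcal{C}$. *)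

theory Defs
  imports Main
begin

definition numerical_semigroup :: "nat set \<Rightarrow> bool" where
  "numerical_semigroup S \<longleftrightarrow>
     0 \<in> S \<and> (\<forall>x\<in>S. \<forall>y\<in>S. x + y \<in> S) \<and> finite (UNIV - S)"

definition multiplicity :: "nat set \<Rightarrow> nat" where
  "multiplicity S = (LEAST x. x \<in> S - {0})"

text \<open>
  The maximum is taken over the integers, so that the Frobenius number of the full
  semigroup of natural numbers is -1.  The set of integers outside S is unbounded below;
  since \<^const>\<open>Max\<close> is only meaningful on finite sets, the greatest element is
  expressed by \<^const>\<open>Greatest\<close>.
\<close>

definition frobenius_number :: "nat set \<Rightarrow> int" where
  "frobenius_number S = (GREATEST z. z \<notin> int ` S)"

text \<open>
  \<^const>\<open>Least\<close> refers to the order on sets, which is inclusion; the value is only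
  meaningful for families that have a minimum.
\<close>

definition min_semigroup :: "nat set set \<Rightarrow> nat set" where
  "min_semigroup C = (LEAST S. S \<in> C)"

definition covariety :: "nat set set \<Rightarrow> bool" where
  "covariety C \<longleftrightarrow>
     C \<noteq> {} \<and>
     (\<forall>S\<in>C. numerical_semigroup S) \<and>
     (\<exists>D\<in>C. \<forall>S\<in>C. D \<subseteq> S) \<and>
     (\<forall>S\<in>C. \<forall>T\<in>C. S \<inter> T \<in> C) \<and>
     (\<forall>S\<in>C. S \<noteq> min_semigroup C \<longrightarrow> S - {multiplicity S} \<in> C)"

definition semigroups_with_frobenius :: "nat \<Rightarrow> nat set set" where
  "semigroups_with_frobenius F = {S. numerical_semigroup S \<and> frobenius_number S = int F}"

end

theory Submission
  imports Defs
begin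

text \<open>Having Frobenius number \<open>F\<close> amounts to \<open>F\<close> being a gap and
  every larger number lying in \<open>S\<close> (\<open>frobenius_number_eq_iff\<close>). This
  condition passes to intersections and forces \<open>0\<close> and all \<open>z > F\<close> into
  \<open>S\<close>; since \<open>F\<close> is nonzero, these numbers alone already form a member,
  hence the minimum. Removing the multiplicity always leaves a numerical semigroup
  (\<open>numerical_semigroup_remove_multiplicity\<close>). A member other than the minimum has a
  nonzero element \<le> \<open>F\<close>, so its multiplicity is \<le> \<open>F\<close> and its
  removal leaves the numbers above \<open>F\<close> untouched.\<close>

lemma frobenius_number_eq_iff:
  assumes "finite (UNIV - S)"
  shows "frobenius_number S = int F \<longleftrightarrow> F \<notin> S \<and> {F<..} \<subseteq> S"
proof
  assume eq: "frobenius_number S = int F"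
  \<comment> \<open>The value -1 keeps the set nonempty and dominates the negative integers.\<close>
  define A where "A = insert (- 1) (int ` (UNIV - S))"
  have fin: "finite A"
    using assms by (simp add: A_def)
  have "Max A \<in> A"
    using fin by (intro Max_in) (auto simp: A_def)
  then have notin: "Max A \<notin> int ` S"
    by (auto simp: A_def)
  have upper: "z \<le> Max A" if "z \<notin> int ` S" for z
  proof (cases "z < 0")
    case True
    have "- 1 \<le> Max A"
      using fin by (intro Max_ge) (auto simp: A_def)
    with True show ?thesis by simp
  next
    case False
    then obtain n where "z = int n"
      by (metis int_eq_iff linorder_not_less)
    with that have "z \<in> A"
      by (auto simp: A_def)
    with fin show ?thesis by simp
  qed
  \<comment> \<open>\<open>GREATEST\<close> is informative only once a greatest element is
    exhibited; \<open>Max A\<close> is that element.\<close>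
  have "Max A = int F"
    using Greatest_equality[of "\<lambda>z. z \<notin> int ` S", OF notin upper] eq
    by (simp add: frobenius_number_def)
  then have "F \<notin> S" and "\<And>n. n \<notin> S \<Longrightarrow> n \<le> F"
    using notin upper[of "int n" for n] by (simp_all add: inj_image_mem_iff)
  then show "F \<notin> S \<and> {F<..} \<subseteq> S"
    by (meson greaterThan_iff not_le subsetI)
next
  assume F: "F \<notin> S \<and> {F<..} \<subseteq> S"
  show "frobenius_number S = int F"
    unfolding frobenius_number_def
  proof (rule Greatest_equality)
    show "int F \<notin> int ` S"
      using F by auto
  next
    fix z
    assume z: "z \<notin> int ` S"
    show "z \<le> int F"
    proof (rule ccontr)
      assume "\<not> z \<le> int F"
      then have "nat z \<in> S" "z = int (nat z)"
        using F by auto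
      with z show False by blast
    qed
  qed
qed

lemma mem_semigroups_with_frobenius_iff:
  "S \<in> semigroups_with_frobenius F \<longleftrightarrow>
     numerical_semigroup S \<and> F \<notin> S \<and> {F<..} \<subseteq> S"
  unfolding semigroups_with_frobenius_def mem_Collect_eq
  \<comment> \<open>\<open>conj_cong\<close> supplies the finite complement while the Frobenius
    condition is rewritten.\<close>
  by (rule conj_cong) (simp_all add: numerical_semigroup_def frobenius_number_eq_iff)

lemma numerical_semigroup_Int:
  "numerical_semigroup S \<Longrightarrow> numerical_semigroup T \<Longrightarrow> numerical_semigroup (S \<inter> T)"
  by (simp add: numerical_semigroup_def Diff_Int)

lemma multiplicity_in:
  assumes "x \<in> S" "x \<noteq> 0"
  shows "multiplicity S \<in> S - {0}"
  unfolding multiplicity_def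
  using LeastI[of "\<lambda>x. x \<in> S - {0}" x] assms by simp

lemma multiplicity_le: "x \<in> S \<Longrightarrow> x \<noteq> 0 \<Longrightarrow> multiplicity S \<le> x"
  unfolding multiplicity_def by (rule Least_le) auto

text \<open>The multiplicity is not a sum of two nonzero elements: each of them is at least the
  multiplicity, so their sum exceeds it.\<close>

lemma numerical_semigroup_remove_multiplicity:
  assumes S: "numerical_semigroup S"
  shows "numerical_semigroup (S - {multiplicity S})"
proof -
  \<comment> \<open>A nonzero element must exist for the multiplicity to be a genuine minimum; then
    it is nonzero and \<open>0\<close> survives the removal.\<close>
  have "infinite S"
    using S by (metis Diff_infinite_finite infinite_UNIV_nat numerical_semigroup_def)
  then have "S - {0} \<noteq> {}"
    by (intro infinite_imp_nonempty) simp
  then obtain s where "s \<in> S" "s \<noteq> 0"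
    by blast
  then have "multiplicity S \<noteq> 0"
    using multiplicity_in[of s S] by simp
  moreover have "x + y \<noteq> multiplicity S"
    if "x \<in> S" "y \<in> S" "x \<noteq> multiplicity S" "y \<noteq> multiplicity S" for x y
  proof (cases "x = 0 \<or> y = 0")
    case False
    then show ?thesis
      using multiplicity_le[of x S] that by simp
  qed (use that in auto)
  moreover have "UNIV - (S - {multiplicity S}) = insert (multiplicity S) (UNIV - S)"
    by blast
  ultimately show ?thesis
    using S by (simp add: numerical_semigroup_def)
qed

lemma numerical_semigroup_ordinary: "numerical_semigroup ({0} \<union> {z. z \<ge> n})"
proof -
  have "UNIV - ({0} \<union> {z. z \<ge> n}) \<subseteq> {..<n}"
    by (auto simp: not_le)
  then have "finite (UNIV - ({0} \<union> {z. z \<ge> n}))"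
    by (rule finite_subset) simp
  then show ?thesis
    by (auto simp: numerical_semigroup_def)
qed

theorem proposition2p4:
  fixes F :: nat
  assumes "F \<noteq> 0"
  shows "covariety (semigroups_with_frobenius F) \<and>
         min_semigroup (semigroups_with_frobenius F) = {0} \<union> {z. z \<ge> F + 1}"
proof -
  let ?A = "semigroups_with_frobenius F"
  let ?D = "{0} \<union> {z. z \<ge> F + 1}"
  \<comment> \<open>\<open>F \<noteq> 0\<close> is what makes \<open>F\<close> a gap of
    \<open>?D\<close>.\<close>
  have D: "?D \<in> ?A"
    using assms numerical_semigroup_ordinary[of "F + 1"]
    by (auto simp: mem_semigroups_with_frobenius_iff)
  have least: "?D \<subseteq> S" if "S \<in> ?A" for S
    using that by (auto simp: mem_semigroups_with_frobenius_iff numerical_semigroup_def)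
  have min: "min_semigroup ?A = ?D"
    unfolding min_semigroup_def using D least by (rule Least_equality)
  have "S - {multiplicity S} \<in> ?A" if S: "S \<in> ?A" and ne: "S \<noteq> ?D" for S
  proof -
    \<comment> \<open>Any element of \<open>S\<close> outside the minimum is nonzero and \<le>
      \<open>F\<close>, which bounds the multiplicity.\<close>
    from least[OF S] ne obtain x where x: "x \<in> S" "x \<notin> ?D"
      by blast
    have "multiplicity S \<le> x"
      using x by (intro multiplicity_le) auto
    with x have "multiplicity S \<le> F"
      by auto
    with S show ?thesis
      by (auto simp: mem_semigroups_with_frobenius_iff numerical_semigroup_remove_multiplicity)
  qed
  moreover have "\<exists>D\<in>?A. \<forall>S\<in>?A. D \<subseteq> S"
    using D least by (intro bexI[of _ ?D]) auto
  moreover have "?A \<noteq> {}"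
    using D by auto
  moreover have "S \<inter> T \<in> ?A" if "S \<in> ?A" "T \<in> ?A" for S T
    using that by (simp add: mem_semigroups_with_frobenius_iff numerical_semigroup_Int)
  moreover have "numerical_semigroup S" if "S \<in> ?A" for S
    using that by (simp add: mem_semigroups_with_frobenius_iff)
  ultimately have "covariety ?A"
    unfolding covariety_def min by simp
  with min show ?thesis
    by blast
qed

end
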